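(* The implicit solver for the $\kappa$-source term satisfies the Abgrall condition: let $\mathbf U^n(x,y)$ be a state on the domain $\Omega$ and let $\mathbf U^{n+1}(x,y)$ be obtained from it by the implicit substep described in the context (partial densities, momentum and total energy unchanged, and $z_1^{n+1}$ a solution of $\frac{z_1^{n+1}-z_1^n}{\Delta t_{\mathrm{im}}}=\kappa^{n+1}\,\nabla\cdot\mathbf u^n$). If $$\mathbf u^n(x,y)\equiv\mathbf u_0,\qquad p^n(x,y)\equiv p_0$$ for a constant vector $\mathbf u_0$ and a constant $p_0$, then $$\mathbf u^{n+1}(x,y)\equiv\mathbf u_0,\qquad p^{n+1}(x,y)\equiv p_0.$$
   Context: Kapila's five-equation two-phase model with the Tammann equation of state, in two space dimensions. The state is $\mathbf U=(z_1\rho_1,z_2\rho_2,\rho\mathbf u,E,z_1)^{\mathrm T}$, where $z_k$ is the volume fraction of phase $k$ ($z_1+z_2=1$), $\rho_k$ the density of phase $k$, $\rho=z_1\rho_1+z_2\rho_2$ the mixture density ($\rho>0$), $\mathbf u$ the velocity, $E$ the total energy. Constants $\gamma_1,\gamma_2>1$ and $p_{w,1},p_{w,2}\in\mathbb R$ are given. The velocity, internal energy and pressure are the functions of $\mathbf U$ $$\mathbf u=\frac{\rho\mathbf u}{\rho},\qquad \rho e=E-\tfrac12\rho|\mathbf u|^2,\qquad p=\rho e(\gamma-1)-\gamma p_w,$$ with mixture parameters $\gamma,p_w$ depending on $z_1$ through $$\frac1{\gamma-1}=\frac{z_1}{\gamma_1-1}+\frac{z_2}{\gamma_2-1},\qquad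 \frac{\gamma p_w}{\gamma-1}=\frac{z_1\gamma_1p_{w,1}}{\gamma_1-1}+\frac{z_2\gamma_2p_{w,2}}{\gamma_2-1}.$$ Implicit substep with step $\Delta t_{\mathrm{im}}>0$: the components $z_1\rho_1$, $z_2\rho_2$, $\rho\mathbf u$, $E$ at level $n+1$ equal those at level $n$, and at each point $z_1^{n+1}$ solves $$\frac{z_1^{n+1}-z_1^n}{\Delta t_{\mathrm{im}}}=\kappa^{n+1}\,\nabla\cdot\mathbf u^n,$$ where $$\kappa^{n+1}=z_1^{n+1}z_2^{n+1}\frac{\nu_1^{n+1}-\nu_2^{n+1}}{\nu^{n+1}},\quad \nu^{n+1}=z_1^{n+1}\nu_1^{n+1}+z_2^{n+1}\nu_2^{n+1},\quad \nu_k^{n+1}=\frac1{\gamma_k(p^{n+1}+p_{w,k})},$$ $$p^{n+1}=(\rho e)^n(\gamma^{n+1}-1)-\gamma^{n+1}p_w^{n+1},$$ and $\gamma^{n+1},p_w^{n+1}$ are the mixture parameters evaluated at $z_1^{n+1}$ (with $z_2^{n+1}=1-z_1^{n+1}$). All these quantities are assumed to be well defined (no vanishing denominators). *)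

theory Defs
  imports "HOL-Analysis.Analysis"
begin

text \<open>Conservative variables of Kapila's five-equation model in two space dimensions. The fields
  \<open>mass1\<close> and \<open>mass2\<close> are the partial densities z1 rho1 and z2 rho2; z2 is always \<open>1 - z1\<close>.\<close>

record kapila_state =
  mass1 :: real
  mass2 :: real
  momentum :: "real ^ 2"
  energy :: real
  vol1 :: real

definition density :: "kapila_state \<Rightarrow> real" where
  "density U = mass1 U + mass2 U"

definition velocity :: "kapila_state \<Rightarrow> real ^ 2" where
  "velocity U = momentum U /\<^sub>R density U"

text \<open>Internal energy per unit volume, rho e.\<close>

definition internal_energy :: "kapila_state \<Rightarrow> real" where
  "internal_energy U = energy U - 1 / 2 * density U * (norm (velocity U))\<^sup>2"

text \<open>The mixture parameters are given implicitly by linear mixing rules for 1 / (gamma - 1) and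
  gamma pw / (gamma - 1). \<open>mix_inv\<close> and \<open>mix_pw\<close> are the right-hand sides of these rules;
  \<open>mixture_gamma\<close> and \<open>mixture_pw\<close> are the solutions, see \<open>mixture_parameters_unique\<close>.\<close>

definition mix_inv :: "real \<Rightarrow> real \<Rightarrow> real \<Rightarrow> real" where
  "mix_inv g1 g2 z1 = z1 / (g1 - 1) + (1 - z1) / (g2 - 1)"

definition mix_pw :: "real \<Rightarrow> real \<Rightarrow> real \<Rightarrow> real \<Rightarrow> real \<Rightarrow> real" where
  "mix_pw g1 g2 pw1 pw2 z1 = z1 * g1 * pw1 / (g1 - 1) + (1 - z1) * g2 * pw2 / (g2 - 1)"

definition mixture_gamma :: "real \<Rightarrow> real \<Rightarrow> real \<Rightarrow> real" where
  "mixture_gamma g1 g2 z1 = 1 + 1 / mix_inv g1 g2 z1"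

definition mixture_pw :: "real \<Rightarrow> real \<Rightarrow> real \<Rightarrow> real \<Rightarrow> real \<Rightarrow> real" where
  "mixture_pw g1 g2 pw1 pw2 z1 =
     (mixture_gamma g1 g2 z1 - 1) / mixture_gamma g1 g2 z1 * mix_pw g1 g2 pw1 pw2 z1"

definition mixture_defined :: "real \<Rightarrow> real \<Rightarrow> real \<Rightarrow> bool" where
  "mixture_defined g1 g2 z1 \<longleftrightarrow> mix_inv g1 g2 z1 \<noteq> 0 \<and> mixture_gamma g1 g2 z1 \<noteq> 0"

lemma mixture_parameters_unique:
  assumes "mixture_defined g1 g2 z1"
  shows "g \<noteq> 1 \<and> 1 / (g - 1) = z1 / (g1 - 1) + (1 - z1) / (g2 - 1) \<and>
         g * pw / (g - 1) = z1 * g1 * pw1 / (g1 - 1) + (1 - z1) * g2 * pw2 / (g2 - 1)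
         \<longleftrightarrow> g = mixture_gamma g1 g2 z1 \<and> pw = mixture_pw g1 g2 pw1 pw2 z1"
proof -
  have "g \<noteq> 1 \<and> 1 / (g - 1) = mix_inv g1 g2 z1 \<longleftrightarrow> g = mixture_gamma g1 g2 z1"
  proof
    assume g: "g \<noteq> 1 \<and> 1 / (g - 1) = mix_inv g1 g2 z1"
    then show "g = mixture_gamma g1 g2 z1"
      unfolding mixture_gamma_def by (simp flip: conjunct2[OF g])
  next
    assume "g = mixture_gamma g1 g2 z1"
    then show "g \<noteq> 1 \<and> 1 / (g - 1) = mix_inv g1 g2 z1"
      using assms unfolding mixture_defined_def mixture_gamma_def by simp
  qed
  moreover have "g * pw / (g - 1) = mix_pw g1 g2 pw1 pw2 z1 \<longleftrightarrow> pw = mixture_pw g1 g2 pw1 pw2 z1"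
    if "g = mixture_gamma g1 g2 z1"
  proof -
    have "g \<noteq> 0" "g - 1 \<noteq> 0"
      using assms that unfolding mixture_defined_def mixture_gamma_def by auto
    then show ?thesis
      unfolding mixture_pw_def that[symmetric] by (auto simp: field_simps)
  qed
  ultimately show ?thesis
    unfolding mix_inv_def mix_pw_def by blast
qed

text \<open>Tammann pressure for internal energy \<open>re\<close> (per unit volume) and volume fraction \<open>z1\<close>.\<close>

definition tammann_pressure :: "real \<Rightarrow> real \<Rightarrow> real \<Rightarrow> real \<Rightarrow> real \<Rightarrow> real \<Rightarrow> real" where
  "tammann_pressure g1 g2 pw1 pw2 re z1 =
     re * (mixture_gamma g1 g2 z1 - 1) - mixture_gamma g1 g2 z1 * mixture_pw g1 g2 pw1 pw2 z1"

definition pressure :: "real \<Rightarrow> real \<Rightarrow> real \<Rightarrow> real \<Rightarrow> kapila_state \<Rightarrow> real" where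
  "pressure g1 g2 pw1 pw2 U = tammann_pressure g1 g2 pw1 pw2 (internal_energy U) (vol1 U)"

definition nu_phase :: "real \<Rightarrow> real \<Rightarrow> real \<Rightarrow> real" where
  "nu_phase g pw p = 1 / (g * (p + pw))"

definition nu_mix :: "real \<Rightarrow> real \<Rightarrow> real \<Rightarrow> real \<Rightarrow> real \<Rightarrow> real \<Rightarrow> real" where
  "nu_mix g1 g2 pw1 pw2 p z1 = z1 * nu_phase g1 pw1 p + (1 - z1) * nu_phase g2 pw2 p"

definition kappa :: "real \<Rightarrow> real \<Rightarrow> real \<Rightarrow> real \<Rightarrow> real \<Rightarrow> real \<Rightarrow> real" where
  "kappa g1 g2 pw1 pw2 p z1 =
     z1 * (1 - z1) * ((nu_phase g1 pw1 p - nu_phase g2 pw2 p) / nu_mix g1 g2 pw1 pw2 p z1)"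

definition kappa_defined :: "real \<Rightarrow> real \<Rightarrow> real \<Rightarrow> real \<Rightarrow> real \<Rightarrow> real \<Rightarrow> bool" where
  "kappa_defined g1 g2 pw1 pw2 p z1 \<longleftrightarrow>
     g1 * (p + pw1) \<noteq> 0 \<and> g2 * (p + pw2) \<noteq> 0 \<and> nu_mix g1 g2 pw1 pw2 p z1 \<noteq> 0"

definition divergence :: "(real ^ 2 \<Rightarrow> real ^ 2) \<Rightarrow> real ^ 2 \<Rightarrow> real" where
  "divergence F x = (\<Sum>i\<in>UNIV. frechet_derivative F (at x) (axis i 1) $ i)"

definition state_defined :: "real \<Rightarrow> real \<Rightarrow> kapila_state \<Rightarrow> bool" where
  "state_defined g1 g2 U \<longleftrightarrow> density U > 0 \<and> mixture_defined g1 g2 (vol1 U)"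

text \<open>\<open>V\<close> is obtained from \<open>U\<close> on \<open>\<Omega>\<close> by the implicit substep of size \<open>dt\<close>. The equation for the
  volume fraction is implicit: kappa and the pressure \<open>p\<close> in it are evaluated at \<open>vol1 (V x)\<close>.
  Because division by zero and \<open>frechet_derivative\<close> are total in HOL, the well-definedness of all
  the quantities involved is part of the definition.\<close>

definition implicit_substep ::
  "real \<Rightarrow> real \<Rightarrow> real \<Rightarrow> real \<Rightarrow> real \<Rightarrow> (real ^ 2) set \<Rightarrow>
   (real ^ 2 \<Rightarrow> kapila_state) \<Rightarrow> (real ^ 2 \<Rightarrow> kapila_state) \<Rightarrow> bool" where
  "implicit_substep g1 g2 pw1 pw2 dt \<Omega> U V \<longleftrightarrow>
     (\<forall>x\<in>\<Omega>.
        state_defined g1 g2 (U x) \<and> state_defined g1 g2 (V x) \<and>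
        (\<lambda>y. velocity (U y)) differentiable (at x) \<and>
        mass1 (V x) = mass1 (U x) \<and>
        mass2 (V x) = mass2 (U x) \<and>
        momentum (V x) = momentum (U x) \<and>
        energy (V x) = energy (U x) \<and>
        (let p = tammann_pressure g1 g2 pw1 pw2 (internal_energy (U x)) (vol1 (V x))
         in kappa_defined g1 g2 pw1 pw2 p (vol1 (V x)) \<and>
            (vol1 (V x) - vol1 (U x)) / dt =
              kappa g1 g2 pw1 pw2 p (vol1 (V x)) * divergence (\<lambda>y. velocity (U y)) x))"

end

theory Submission
  imports Defs
begin

text \<open>A velocity that is constant on an open set has zero divergence there
  (\<open>divergence_eq_0_if_constant_on_open\<close>). The source term of the implicit equation is
  then zero for any value of \<open>kappa\<close> at the new level, so its solution keeps the volume
  fraction. Every other field is copied by the substep, hence the state itself is a fixed point, and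
  velocity and pressure, being functions of the state, are preserved.\<close>

lemma divergence_eq_0_if_constant_on_open:
  assumes "open S" and "x \<in> S" and "\<And>y. y \<in> S \<Longrightarrow> F y = c"
  shows "divergence F x = 0"
proof -
  have "((\<lambda>_. c) has_derivative (\<lambda>_. 0)) (at x)"
    by simp
  \<comment> \<open>Differentiability is local: \<open>F\<close> agrees with the constant map on the
    open neighbourhood \<open>S\<close> of \<open>x\<close>.\<close>
  then have "(F has_derivative (\<lambda>_. 0)) (at x)"
    by (rule has_derivative_transform_within_open) (use assms in auto)
  then have "frechet_derivative F (at x) = (\<lambda>_. 0)"
    by (rule frechet_derivative_at[symmetric])
  then show ?thesis
    by (simp add: divergence_def)
qed

theorem theorem3p2:
  fixes g1 g2 pw1 pw2 dt p0 :: real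
    and u0 :: "real ^ 2"
    and \<Omega> :: "(real ^ 2) set"
    and U V :: "real ^ 2 \<Rightarrow> kapila_state"
  assumes "g1 > 1" and "g2 > 1"
    and "dt > 0"
    and "open \<Omega>"
    and "implicit_substep g1 g2 pw1 pw2 dt \<Omega> U V"
    and "\<forall>x\<in>\<Omega>. velocity (U x) = u0"
    and "\<forall>x\<in>\<Omega>. pressure g1 g2 pw1 pw2 (U x) = p0"
  shows "(\<forall>x\<in>\<Omega>. velocity (V x) = u0) \<and> (\<forall>x\<in>\<Omega>. pressure g1 g2 pw1 pw2 (V x) = p0)"
proof -
  have "V x = U x" if x: "x \<in> \<Omega>" for x
  proof -
    have "divergence (\<lambda>y. velocity (U y)) x = 0"
      using assms(4,6) x by (intro divergence_eq_0_if_constant_on_open) auto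
    then have "(vol1 (V x) - vol1 (U x)) / dt = 0"
      using assms(5) x by (simp add: implicit_substep_def Let_def)
    then have "vol1 (V x) = vol1 (U x)"
      using assms(3) by simp
    \<comment> \<open>The substep copies the other four fields, so the two records agree field by
      field.\<close>
    then show ?thesis
      using assms(5) x by (simp add: implicit_substep_def)
  qed
  then show ?thesis
    using assms(6,7) by simp
qed

end
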